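(* A permutation $\pi$ avoids $\xi$ if and only if each block in the first-element decomposition of $\pi$ is increasing.
   Context: Permutations $\pi=\pi_1\cdots\pi_n$ of $\{1,\dots,n\}$, $n\ge1$, are written in one-line notation. $\xi=(132,\{0,2\},\emptyset)$ is a bivincular pattern: $\pi$ contains $\xi$ if there is an index $j\ge 2$ with $j+1\le n$ such that $\pi_1<\pi_{j+1}<\pi_j$ (that is, $\pi_1\pi_j\pi_{j+1}$ is an occurrence of $132$ starting at the first entry of $\pi$ and whose last two entries are adjacent in position); otherwise $\pi$ avoids $\xi$. First-element decomposition: let $\pi_1=t+1$ with $t\ge 0$. Write $\pi=\pi_1 B_0 b_1 B_1 b_2 B_2\cdots b_t B_t$, where $b_1,\dots,b_t$ are the entries of $\pi$ smaller than $\pi_1$, listed in order of appearance from left to right (so $\{b_1,\dots,b_t\}=\{1,\dots,t\}$), $B_0$ is the (possibly empty) sequence of entries between $\pi_1$ and $b_1$, $B_i$ for $1\le i<t$ is the (possibly empty) sequence of entries between $b_i$ and $b_{i+1}$, and $B_t$ is the (possibly empty) sequence of entries after $b_t$ (if $t=0$, $B_0$ consists of all entries after $\pi_1$). The sequences $B_0,\dots,B_t$ are the blocks. A block is increasing if its entries increase from left to right (an empty block is increasing). *)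

theory Defs
  imports "HOL-Combinatorics.Multiset_Permutations"
begin

text \<open>A permutation of \<open>{1..n}\<close> in one-line notation is an element of
  \<^term>\<open>permutations_of_set {1..n}\<close>, i.e. a distinct list whose set of entries is \<open>{1..n}\<close>.
  \<open>entry p i\<close> is the \<open>i\<close>-th entry, counting from 1; it is only used for \<open>1 \<le> i \<le> length p\<close>.\<close>

definition entry :: "nat list \<Rightarrow> nat \<Rightarrow> nat" where
  "entry p i = p ! (i - 1)"

text \<open>Containment of the bivincular pattern \<open>\<xi> = (132, {0,2}, {})\<close>: an occurrence of \<open>132\<close> that starts
  at the first entry and whose last two entries are adjacent in position.\<close>

definition contains_xi :: "nat list \<Rightarrow> bool" where
  "contains_xi p \<longleftrightarrow>
     (\<exists>j\<ge>2. j + 1 \<le> length p \<and> entry p 1 < entry p (j + 1) \<and> entry p (j + 1) < entry p j)"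

definition avoids_xi :: "nat list \<Rightarrow> bool" where
  "avoids_xi p \<longleftrightarrow> \<not> contains_xi p"

text \<open>\<open>split_below a xs\<close> cuts \<open>xs\<close> at its entries smaller than \<open>a\<close>, which are removed; empty pieces are
  kept, so there is always one more piece than there are such entries.\<close>

fun split_below :: "nat \<Rightarrow> nat list \<Rightarrow> nat list list" where
  "split_below a [] = [[]]"
| "split_below a (x # xs) =
     (if x < a then [] # split_below a xs
      else (x # hd (split_below a xs)) # tl (split_below a xs))"

text \<open>The entries \<open>b\<^sub>1, \<dots>, b\<^sub>t\<close> and the blocks \<open>B\<^sub>0, \<dots>, B\<^sub>t\<close> of the first-element decomposition.\<close>

definition smaller_entries :: "nat list \<Rightarrow> nat list" where
  "smaller_entries p = filter (\<lambda>x. x < hd p) (tl p)"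

definition blocks :: "nat list \<Rightarrow> nat list list" where
  "blocks p = split_below (hd p) (tl p)"

definition increasing :: "nat list \<Rightarrow> bool" where
  "increasing B \<longleftrightarrow> sorted_wrt (<) B"

text \<open>For a permutation, \<open>blocks\<close> is the unique solution of \<open>p = p\<^sub>1 B\<^sub>0 b\<^sub>1 B\<^sub>1 \<dots> b\<^sub>t B\<^sub>t\<close>, and
  \<open>{b\<^sub>1, \<dots>, b\<^sub>t} = {1..t}\<close> where \<open>p\<^sub>1 = t + 1\<close>.\<close>

lemma length_split_below:
  "length (split_below a xs) = Suc (length (filter (\<lambda>x. x < a) xs))"
  by (induction xs) auto

lemma concat_split_below:
  "hd (split_below a xs) @ concat (map2 (#) (filter (\<lambda>x. x < a) xs) (tl (split_below a xs))) = xs"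
proof (induction xs)
  case (Cons x xs)
  have "split_below a xs \<noteq> []" using length_split_below[of a xs] by auto
  then obtain B Bs where "split_below a xs = B # Bs" by (cases "split_below a xs") auto
  with Cons.IH show ?case by simp
qed simp

lemma split_below_append:
  "\<forall>x\<in>set B. \<not> x < a \<Longrightarrow>
     split_below a (B @ xs) = (B @ hd (split_below a xs)) # tl (split_below a xs)"
proof (induction B)
  case Nil
  have "split_below a xs \<noteq> []" using length_split_below[of a xs] by auto
  then show ?case by simp
qed simp

lemma split_below_concat:
  assumes "length Bs = Suc (length bs)" and "\<forall>B\<in>set Bs. \<forall>x\<in>set B. \<not> x < a" and "\<forall>b\<in>set bs. b < a"
  shows "split_below a (hd Bs @ concat (map2 (#) bs (tl Bs))) = Bs"
  using assms
proof (induction bs arbitrary: Bs)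
  case Nil
  then obtain B where "Bs = [B]" by (cases Bs) auto
  with Nil show ?case using split_below_append[of B a "[]"] by simp
next
  case (Cons b bs)
  then obtain B C Cs where Bs: "Bs = B # C # Cs" by (cases Bs; cases "tl Bs") auto
  have "split_below a (C @ concat (map2 (#) bs Cs)) = C # Cs"
    using Cons.IH[of "C # Cs"] Cons.prems Bs by simp
  moreover have "\<forall>x\<in>set B. \<not> x < a" "b < a" using Cons.prems Bs by auto
  ultimately show ?case using Bs by (simp add: split_below_append)
qed

lemma mset_concat_map2_Cons:
  "length bs = length Cs \<Longrightarrow> mset (concat (map2 (#) bs Cs)) = mset bs + mset (concat Cs)"
  by (induction bs Cs rule: list_induct2) auto

lemma split_below_unique:
  "split_below a xs = Bs \<longleftrightarrow>
     length Bs = Suc (length (filter (\<lambda>x. x < a) xs)) \<and>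
     xs = hd Bs @ concat (map2 (#) (filter (\<lambda>x. x < a) xs) (tl Bs))"
proof
  assume Bs: "split_below a xs = Bs"
  show "length Bs = Suc (length (filter (\<lambda>x. x < a) xs)) \<and>
     xs = hd Bs @ concat (map2 (#) (filter (\<lambda>x. x < a) xs) (tl Bs))"
    using length_split_below[of a xs] concat_split_below[of a xs, symmetric]
    unfolding Bs by (rule conjI)
next
  assume R: "length Bs = Suc (length (filter (\<lambda>x. x < a) xs)) \<and>
     xs = hd Bs @ concat (map2 (#) (filter (\<lambda>x. x < a) xs) (tl Bs))"
  define bs where "bs = filter (\<lambda>x. x < a) xs"
  have len: "length Bs = Suc (length bs)" and xs: "xs = hd Bs @ concat (map2 (#) bs (tl Bs))"
    using R[folded bs_def, THEN conjunct1] R[folded bs_def, THEN conjunct2] .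
  obtain B Cs where Bs: "Bs = B # Cs" "length bs = length Cs" using len by (cases Bs) auto
  have ms: "mset xs = mset bs + mset (concat Bs)"
    by (subst xs) (simp add: Bs mset_concat_map2_Cons)
  have "mset bs = filter_mset (\<lambda>x. x < a) (mset xs)" by (simp add: bs_def)
  also have "\<dots> = filter_mset (\<lambda>x. x < a) (mset bs) + filter_mset (\<lambda>x. x < a) (mset (concat Bs))"
    by (simp only: ms filter_union_mset)
  also have "filter_mset (\<lambda>x. x < a) (mset bs) = mset bs"
    by (simp add: bs_def filter_mset_eq_conv)
  finally have "filter_mset (\<lambda>x. x < a) (mset (concat Bs)) = {#}" by simp
  then have "set_mset (filter_mset (\<lambda>x. x < a) (mset (concat Bs))) = {}" by (simp only: set_mset_empty)
  then have "\<forall>x\<in>set (concat Bs). \<not> x < a"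
    unfolding set_mset_filter set_mset_mset by blast
  then have "\<forall>B\<in>set Bs. \<forall>x\<in>set B. \<not> x < a" by auto
  moreover have "\<forall>b\<in>set bs. b < a" by (simp add: bs_def)
  ultimately have "split_below a (hd Bs @ concat (map2 (#) bs (tl Bs))) = Bs"
    using split_below_concat[OF len] by blast
  then show "split_below a xs = Bs" by (simp only: xs[symmetric])
qed

lemma blocks_unique:
  assumes "p \<in> permutations_of_set {1..n}" and "n \<ge> 1"
  shows "blocks p = Bs \<longleftrightarrow>
     length Bs = Suc (length (smaller_entries p)) \<and>
     p = hd p # hd Bs @ concat (map2 (#) (smaller_entries p) (tl Bs))"
proof -
  have "p \<noteq> []" using assms by (auto simp: permutations_of_set_def)
  then obtain a xs where p: "p = a # xs" by (cases p) auto
  show ?thesis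
    using split_below_unique[of a xs Bs]
    unfolding blocks_def smaller_entries_def p list.sel list.inject by (simp only: simp_thms)
qed

lemma set_smaller_entries:
  assumes "p \<in> permutations_of_set {1..n}" and "hd p = t + 1" and "n \<ge> 1"
  shows "set (smaller_entries p) = {1..t}" and "length (smaller_entries p) = t"
proof -
  have s: "p \<noteq> []" "distinct p" "set p = {1..n}"
    using assms by (auto simp: permutations_of_set_def)
  define xs where "xs = tl p"
  have p: "p = (t + 1) # xs" using s(1) assms(2) xs_def by (metis list.collapse)
  have "t + 1 \<in> set p" "t + 1 \<notin> set xs" and set_p: "set p = insert (t + 1) (set xs)"
    using s(2) unfolding p by simp_all
  have "t + 1 \<le> n" using \<open>t + 1 \<in> set p\<close> unfolding s(3) by simp
  have xs: "set xs = {1..n} - {t + 1}"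
    unfolding s(3)[symmetric] set_p using \<open>t + 1 \<notin> set xs\<close> by blast
  have "smaller_entries p = filter (\<lambda>x. x < t + 1) xs"
    unfolding smaller_entries_def p list.sel ..
  then have "set (smaller_entries p) = {x \<in> {1..n} - {t + 1}. x < t + 1}"
    by (simp only: set_filter xs)
  also have "\<dots> = {1..t}" using \<open>t + 1 \<le> n\<close> by fastforce
  finally show set_eq: "set (smaller_entries p) = {1..t}" .
  have "distinct (smaller_entries p)"
    unfolding smaller_entries_def using s(2) by (simp add: distinct_tl)
  from distinct_card[OF this] show "length (smaller_entries p) = t"
    unfolding set_eq by simp
qed

end

theory Submission
  imports Defs
begin

text \<open>Both sides amount to one condition on adjacent entries \<open>x\<close>,
  \<open>y\<close> after the first entry \<open>a\<close>: if \<open>a \<le> y\<close> then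
  \<open>x < y\<close>. For blocks this is \<open>split_below_increasing_iff_successively\<close>;
  for the pattern it is \<open>avoids_xi_Cons_iff_successively\<close>, since a violation is exactly
  \<open>a < y < x\<close>.\<close>

text \<open>If \<open>y < a\<close>, then \<open>y\<close> is a separator and nothing is required.
  If \<open>x < a \<le> y\<close>, then \<open>x < y\<close> is automatic. Otherwise
  \<open>x\<close> and \<open>y\<close> are neighbours in one block, and a block increases as soon
  as its neighbours do.\<close>

lemma split_below_increasing_iff_successively:
  "(\<forall>B\<in>set (split_below a xs). increasing B) \<longleftrightarrow>
     successively (\<lambda>x y. a \<le> y \<longrightarrow> x < y) xs"
proof (induction xs rule: induct_list012)
  case (3 x y zs)
  obtain B Bs where "split_below a zs = B # Bs"
    using length_split_below[of a zs] by (cases "split_below a zs") auto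
  with "3.IH"(2) show ?case
    \<comment> \<open>Transitivity carries \<open>x < y\<close> to the entries after
      \<open>y\<close> in their common block.\<close>
    by (auto simp: increasing_def intro: less_trans)
qed (auto simp: increasing_def)

lemma avoids_xi_Cons_iff_successively:
  assumes "distinct (a # xs)"
  shows "avoids_xi (a # xs) \<longleftrightarrow> successively (\<lambda>x y. a \<le> y \<longrightarrow> x < y) xs"
proof -
  have "contains_xi (a # xs) \<longleftrightarrow>
      (\<exists>i. Suc i < length xs \<and> a < xs ! Suc i \<and> xs ! Suc i < xs ! i)"
  proof
    assume "contains_xi (a # xs)"
    then obtain j where "j \<ge> 2" "j \<le> length xs" "a < xs ! (j - 1)" "xs ! (j - 1) < xs ! (j - 2)"
      by (auto simp: contains_xi_def entry_def nth_Cons' numeral_2_eq_2)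
    moreover from \<open>j \<ge> 2\<close> have "Suc (j - 2) = j - 1" by simp
    ultimately show "\<exists>i. Suc i < length xs \<and> a < xs ! Suc i \<and> xs ! Suc i < xs ! i"
      \<comment> \<open>\<open>j\<close> counts from 1 in \<open>a # xs\<close>, whereas
        \<open>i\<close> counts from 0 in \<open>xs\<close>.\<close>
      by (intro exI[of _ "j - 2"]) auto
  next
    assume "\<exists>i. Suc i < length xs \<and> a < xs ! Suc i \<and> xs ! Suc i < xs ! i"
    then obtain i where "Suc i < length xs" "a < xs ! Suc i" "xs ! Suc i < xs ! i" by blast
    then show "contains_xi (a # xs)"
      unfolding contains_xi_def entry_def by (intro exI[of _ "i + 2"]) auto
  qed
  \<comment> \<open>Without ties, the negation of \<open>a < y < x\<close> is
    \<open>a \<le> y \<longrightarrow> x < y\<close>.\<close>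
  moreover have "a \<noteq> xs ! Suc i" "xs ! Suc i \<noteq> xs ! i" if "Suc i < length xs" for i
    using that assms by (auto simp: nth_eq_iff_index_eq)
  ultimately show ?thesis
    unfolding avoids_xi_def successively_conv_nth by (meson le_less linorder_neqE_nat not_less)
qed

theorem lemma3:
  fixes n :: nat and p :: "nat list"
  assumes "n \<ge> 1" and "p \<in> permutations_of_set {1..n}"
  shows "avoids_xi p \<longleftrightarrow> (\<forall>B \<in> set (blocks p). increasing B)"
proof -
  have "p \<noteq> []" "distinct p"
    using assms by (auto simp: permutations_of_set_def)
  then obtain a xs where p: "p = a # xs" "distinct (a # xs)"
    by (cases p) auto
  show ?thesis
    unfolding blocks_def p(1) list.sel split_below_increasing_iff_successively
    by (rule avoids_xi_Cons_iff_successively[OF p(2)])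
qed

end
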